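(* Let $M$ and $D$ be categories, let $\mathrm{Inf}: M \to D$ be a functor, let $S$ be a monoidal preorder whose identity 1-morphism $\mathrm{Id}_*$ is a bottom element, and let $\mathrm{Err}: D \to S$ be an $S$ flavoured error on $D$. Suppose that $\mathrm{Inf}$ has a left adjoint $\mathrm{Alg}: D \to M$. Then for every object $d$ of $D$, $\mathrm{Alg}(d)$ is a global error minimiser with respect to $d$; that is, for every object $m$ of $M$, $$\mathrm{Err}(d, \mathrm{Inf}(\mathrm{Alg}(d))) \le_S \mathrm{Err}(d, \mathrm{Inf}(m)).$$
   Context: A monoidal preorder $S$ is a (strict) 2-category with a single object $*$ and at most one 2-morphism between any pair of 1-morphisms; equivalently, its 1-morphisms form a monoid with unit $\mathrm{Id}_*$, carrying a preorder ($a \le b$ iff there is a 2-morphism $a \Rightarrow b$) for which multiplication is monotone in both variables. A bottom element is an element $\bot$ with $\bot \le a$ for all $a$. Given a monoidal preorder $S$ in which $\mathrm{Id}_*$ is a bottom element, an $S$ flavoured error on a category $D$ is a lax 2-functor $\mathrm{Err}: D \to S$, where $D$ is regarded as a 2-category with only identity 2-morphisms. Concretely, it assigns to every morphism $f$ of $D$ a 1-morphism $\mathrm{Err}(f)$ of $S$ such that $\mathrm{Err}(g)\mathrm{Err}(f) \le \mathrm{Err}(gf)$ for composable $f,g$ and $\mathrm{Id}_* \le \mathrm{Err}(\mathrm{Id}_x)$ for every object $x$ (the coherence conditions are automatic since $S$ has at most one 2-morphism between 1-morphisms). Error comparison: for objects $x,y,z,w$ of $D$, the notation $\mathrm{Err}(x,y)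 \le_S \mathrm{Err}(z,w)$ means that for every morphism $f: z \to w$ in $D$ there exists a morphism $g: x \to y$ in $D$ and a 2-morphism $\mathrm{Err}(g) \Rightarrow \mathrm{Err}(f)$ in $S$ (i.e. $\mathrm{Err}(g) \le \mathrm{Err}(f)$). The symbol $\mathrm{Err}(x,y)$ by itself is only notation and not an element of $S$. An object $x$ of $M$ is a global error minimiser with respect to $d$ if $\mathrm{Err}(d,\mathrm{Inf}(x)) \le_S \mathrm{Err}(d,\mathrm{Inf}(m))$ for every object $m$ of $M$. *)

theory Defs
  imports "HOL-Algebra.Group"
begin

record ('o, 'm) cat =
  Obj :: "'o set"
  Mor :: "'m set"
  Dom :: "'m \<Rightarrow> 'o"
  Cod :: "'m \<Rightarrow> 'o"
  Ident :: "'o \<Rightarrow> 'm"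
  Comp :: "'m \<Rightarrow> 'm \<Rightarrow> 'm"  (infixr "\<odot>\<index>" 70)

text \<open>Composition is written in applicative order: \<open>g \<odot> f\<close> is ``first f, then g''. It is
  unconstrained on non-composable pairs.\<close>

definition Hom :: "('o, 'm, 'z) cat_scheme \<Rightarrow> 'o \<Rightarrow> 'o \<Rightarrow> 'm set"
  where "Hom C x y = {f \<in> Mor C. Dom C f = x \<and> Cod C f = y}"

locale category =
  fixes C :: "('o, 'm, 'z) cat_scheme" (structure)
  assumes dom_obj: "f \<in> Mor C \<Longrightarrow> Dom C f \<in> Obj C"
    and cod_obj: "f \<in> Mor C \<Longrightarrow> Cod C f \<in> Obj C"
    and ident_hom: "x \<in> Obj C \<Longrightarrow> Ident C x \<in> Hom C x x"
    and comp_hom: "\<lbrakk>f \<in> Hom C x y; g \<in> Hom C y z\<rbrakk> \<Longrightarrow> g \<odot> f \<in> Hom C x z"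
    and comp_assoc: "\<lbrakk>f \<in> Hom C w x; g \<in> Hom C x y; h \<in> Hom C y z\<rbrakk>
      \<Longrightarrow> (h \<odot> g) \<odot> f = h \<odot> (g \<odot> f)"
    and ident_left: "f \<in> Hom C x y \<Longrightarrow> Ident C y \<odot> f = f"
    and ident_right: "f \<in> Hom C x y \<Longrightarrow> f \<odot> Ident C x = f"

record ('o, 'm, 'p, 'n) cat_map =
  on_obj :: "'o \<Rightarrow> 'p"
  on_mor :: "'m \<Rightarrow> 'n"

locale cat_functor = A: category A + B: category B
  for A :: "('o, 'm, 'y) cat_scheme" and B :: "('p, 'n, 'z) cat_scheme" +
  fixes F :: "('o, 'm, 'p, 'n) cat_map"
  assumes map_obj: "x \<in> Obj A \<Longrightarrow> on_obj F x \<in> Obj B"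
    and map_hom: "f \<in> Hom A x y \<Longrightarrow> on_mor F f \<in> Hom B (on_obj F x) (on_obj F y)"
    and map_ident: "x \<in> Obj A \<Longrightarrow> on_mor F (Ident A x) = Ident B (on_obj F x)"
    and map_comp: "\<lbrakk>f \<in> Hom A x y; g \<in> Hom A y z\<rbrakk>
      \<Longrightarrow> on_mor F (g \<odot>\<^bsub>A\<^esub> f) = on_mor F g \<odot>\<^bsub>B\<^esub> on_mor F f"

text \<open>\<open>F : D \<rightarrow> M\<close> is left adjoint to \<open>G : M \<rightarrow> D\<close>, witnessed by the bijections
  \<open>\<phi> d m : Hom M (F d) m \<rightarrow> Hom D d (G m)\<close>, natural in both variables.\<close>

locale adjunction = F: cat_functor D M F + G: cat_functor M D G
  for D :: "('p, 'n, 'z) cat_scheme" and M :: "('o, 'm, 'y) cat_scheme"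
    and F :: "('p, 'n, 'o, 'm) cat_map" and G :: "('o, 'm, 'p, 'n) cat_map" +
  fixes \<phi> :: "'p \<Rightarrow> 'o \<Rightarrow> 'm \<Rightarrow> 'n"
  assumes transpose_bij: "\<lbrakk>d \<in> Obj D; m \<in> Obj M\<rbrakk>
      \<Longrightarrow> bij_betw (\<phi> d m) (Hom M (on_obj F d) m) (Hom D d (on_obj G m))"
    and transpose_natural:
      "\<lbrakk>h \<in> Hom D d' d; f \<in> Hom M (on_obj F d) m; k \<in> Hom M m m'\<rbrakk>
      \<Longrightarrow> \<phi> d' m' (k \<odot>\<^bsub>M\<^esub> f \<odot>\<^bsub>M\<^esub> on_mor F h) = on_mor G k \<odot>\<^bsub>D\<^esub> \<phi> d m f \<odot>\<^bsub>D\<^esub> h"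

definition left_adjoint ::
  "('p, 'n, 'z) cat_scheme \<Rightarrow> ('o, 'm, 'y) cat_scheme \<Rightarrow>
   ('p, 'n, 'o, 'm) cat_map \<Rightarrow> ('o, 'm, 'p, 'n) cat_map \<Rightarrow> bool"
  where "left_adjoint D M F G \<longleftrightarrow> (\<exists>\<phi>. adjunction D M F G \<phi>)"

text \<open>The 1-morphisms of the one-object 2-category form the carrier, horizontal composition is the
  monoid multiplication, and \<open>a \<preceq> b\<close> says that there is a 2-morphism from \<open>a\<close> to \<open>b\<close>.
  Neither antisymmetry nor commutativity is required.\<close>

record 's preordered_monoid = "'s monoid" +
  two_mor :: "'s \<Rightarrow> 's \<Rightarrow> bool"  (infix "\<preceq>\<index>" 50)

locale monoidal_preorder = monoid S for S :: "('s, 'z) preordered_monoid_scheme" (structure) +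
  assumes le_refl: "a \<in> carrier S \<Longrightarrow> a \<preceq> a"
    and le_trans: "\<lbrakk>a \<in> carrier S; b \<in> carrier S; c \<in> carrier S; a \<preceq> b; b \<preceq> c\<rbrakk> \<Longrightarrow> a \<preceq> c"
    and mult_mono: "\<lbrakk>a \<in> carrier S; a' \<in> carrier S; b \<in> carrier S; b' \<in> carrier S;
      a \<preceq> a'; b \<preceq> b'\<rbrakk> \<Longrightarrow> a \<otimes> b \<preceq> a' \<otimes> b'"

definition bottom_element :: "('s, 'z) preordered_monoid_scheme \<Rightarrow> 's \<Rightarrow> bool"
  where "bottom_element S b \<longleftrightarrow> b \<in> carrier S \<and> (\<forall>a \<in> carrier S. b \<preceq>\<^bsub>S\<^esub> a)"

text \<open>A lax 2-functor from \<open>D\<close>, with only identity 2-morphisms, to \<open>S\<close>. The object part is trivial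
  and the coherence conditions hold automatically because 2-morphisms of \<open>S\<close> are unique.\<close>

locale flavoured_error = D: category D + S: monoidal_preorder S
  for D :: "('p, 'n, 'z) cat_scheme" and S :: "('s, 'y) preordered_monoid_scheme" +
  fixes Err :: "'n \<Rightarrow> 's"
  assumes unit_bottom: "bottom_element S \<one>\<^bsub>S\<^esub>"
    and err_carrier: "f \<in> Mor D \<Longrightarrow> Err f \<in> carrier S"
    and err_comp: "\<lbrakk>f \<in> Hom D x y; g \<in> Hom D y z\<rbrakk>
      \<Longrightarrow> Err g \<otimes>\<^bsub>S\<^esub> Err f \<preceq>\<^bsub>S\<^esub> Err (g \<odot>\<^bsub>D\<^esub> f)"
    and err_ident: "x \<in> Obj D \<Longrightarrow> \<one>\<^bsub>S\<^esub> \<preceq>\<^bsub>S\<^esub> Err (Ident D x)"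

text \<open>\<open>err_le D S Err x y z w\<close> is the comparison \<open>Err(x, y) \<le> Err(z, w)\<close>; the quantifier over the
  right-hand hom-set comes first.\<close>

definition err_le ::
  "('p, 'n, 'z) cat_scheme \<Rightarrow> ('s, 'y) preordered_monoid_scheme \<Rightarrow> ('n \<Rightarrow> 's) \<Rightarrow>
   'p \<Rightarrow> 'p \<Rightarrow> 'p \<Rightarrow> 'p \<Rightarrow> bool"
  where "err_le D S Err x y z w \<longleftrightarrow>
    (\<forall>f \<in> Hom D z w. \<exists>g \<in> Hom D x y. Err g \<preceq>\<^bsub>S\<^esub> Err f)"

definition global_error_minimiser ::
  "('o, 'm, 'x) cat_scheme \<Rightarrow> ('p, 'n, 'z) cat_scheme \<Rightarrow> ('o, 'm, 'p, 'n) cat_map \<Rightarrow>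
   ('s, 'y) preordered_monoid_scheme \<Rightarrow> ('n \<Rightarrow> 's) \<Rightarrow> 'p \<Rightarrow> 'o \<Rightarrow> bool"
  where "global_error_minimiser M D InfF S Err d x \<longleftrightarrow> x \<in> Obj M \<and>
    (\<forall>m \<in> Obj M. err_le D S Err d (on_obj InfF x) d (on_obj InfF m))"

end

theory Submission
  imports Defs
begin

text \<open>Every \<open>f : d \<rightarrow> Inf m\<close> factors through the unit \<open>\<eta>\<close> of the adjunction as
  \<open>f = Inf k \<odot> \<eta>\<close>. Since \<open>Id\<close> is a bottom element and \<open>Err\<close> is lax, postcomposition never decreases
  the error: \<open>Err \<eta> = Id \<otimes> Err \<eta> \<preceq> Err (Inf k) \<otimes> Err \<eta> \<preceq> Err f\<close>. So \<open>\<eta>\<close> is the required witness.\<close>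

lemma (in flavoured_error) err_le_err_comp:
  assumes f: "f \<in> Hom D x y" and g: "g \<in> Hom D y z"
  shows "Err f \<preceq>\<^bsub>S\<^esub> Err (g \<odot>\<^bsub>D\<^esub> f)"
proof -
  have c: "Err f \<in> carrier S" "Err g \<in> carrier S" "Err (g \<odot>\<^bsub>D\<^esub> f) \<in> carrier S"
    using f g D.comp_hom[OF f g] by (auto simp: Hom_def intro: err_carrier)
  have "\<one>\<^bsub>S\<^esub> \<preceq>\<^bsub>S\<^esub> Err g"
    using unit_bottom c by (simp add: bottom_element_def)
  then have "\<one>\<^bsub>S\<^esub> \<otimes>\<^bsub>S\<^esub> Err f \<preceq>\<^bsub>S\<^esub> Err g \<otimes>\<^bsub>S\<^esub> Err f"
    using c by (intro S.mult_mono S.le_refl) auto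
  then have "Err f \<preceq>\<^bsub>S\<^esub> Err g \<otimes>\<^bsub>S\<^esub> Err f"
    using c by simp
  then show ?thesis
    using c err_comp[OF f g] S.le_trans[of "Err f" "Err g \<otimes>\<^bsub>S\<^esub> Err f"] by simp
qed

text \<open>The adjunction is presented by hom-set bijections, so its unit has to be recovered from
  them: it is the universal element that the Yoneda lemma attaches to
  \<open>\<phi> d\<close>.\<close>

definition (in adjunction) unit :: "'p \<Rightarrow> 'n"
  where "unit d = \<phi> d (on_obj F d) (Ident M (on_obj F d))"

context adjunction
begin

lemma unit_hom:
  assumes d: "d \<in> Obj D"
  shows "unit d \<in> Hom D d (on_obj G (on_obj F d))"
  unfolding unit_def
  using bij_betwE[OF transpose_bij[OF d F.map_obj[OF d]]] F.B.ident_hom[OF F.map_obj[OF d]]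
  by blast

text \<open>Yoneda argument: naturality in \<open>m\<close> lets \<open>k\<close> be pulled out of
  the transpose, leaving the transpose of an identity.\<close>

lemma transpose_eq_comp_unit:
  assumes d: "d \<in> Obj D" and k: "k \<in> Hom M (on_obj F d) m"
  shows "\<phi> d m k = on_mor G k \<odot>\<^bsub>D\<^esub> unit d"
proof -
  have i: "Ident M (on_obj F d) \<in> Hom M (on_obj F d) (on_obj F d)"
    using F.map_obj[OF d] by (rule F.B.ident_hom)
  show ?thesis
    \<comment> \<open>Naturality at the identities of \<open>d\<close> and
      \<open>on_obj F d\<close>; the unit laws then remove the identities on both sides.\<close>
    using transpose_natural[OF F.A.ident_hom[OF d] i k] unit_hom[OF d]
    by (simp add: unit_def F.map_ident[OF d] F.B.ident_left[OF i] F.B.ident_right[OF k]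
        F.A.ident_right)
qed

text \<open>Surjectivity of the transpose provides \<open>k\<close> as a preimage of
  \<open>f\<close>.\<close>

lemma hom_factors_through_unit:
  assumes d: "d \<in> Obj D" and m: "m \<in> Obj M" and f: "f \<in> Hom D d (on_obj G m)"
  obtains k where "k \<in> Hom M (on_obj F d) m" and "f = on_mor G k \<odot>\<^bsub>D\<^esub> unit d"
proof -
  have "f \<in> \<phi> d m ` Hom M (on_obj F d) m"
    using f transpose_bij[OF d m] by (simp add: bij_betw_def)
  then show thesis
    using that transpose_eq_comp_unit[OF d] by auto
qed

end

theorem theorem3p9:
  fixes M :: "('o, 'm) cat" and D :: "('p, 'n) cat"
    and InfF :: "('o, 'm, 'p, 'n) cat_map" and AlgF :: "('p, 'n, 'o, 'm) cat_map"
    and S :: "'s preordered_monoid" and Err :: "'n \<Rightarrow> 's"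
  assumes "category M" and "category D"
    and "cat_functor M D InfF"
    and "monoidal_preorder S" and "bottom_element S \<one>\<^bsub>S\<^esub>"
    and "flavoured_error D S Err"
    and "left_adjoint D M AlgF InfF"
  shows "\<forall>d \<in> Obj D. global_error_minimiser M D InfF S Err d (on_obj AlgF d)"
proof
  fix d assume d: "d \<in> Obj D"
  obtain \<phi> where "adjunction D M AlgF InfF \<phi>"
    using \<open>left_adjoint D M AlgF InfF\<close> by (auto simp: left_adjoint_def)
  then interpret adjunction D M AlgF InfF \<phi> .
  interpret flavoured_error D S Err by fact
  have "err_le D S Err d (on_obj InfF (on_obj AlgF d)) d (on_obj InfF m)" if m: "m \<in> Obj M" for m
    unfolding err_le_def
  proof
    fix f assume "f \<in> Hom D d (on_obj InfF m)"
    then obtain k where k: "k \<in> Hom M (on_obj AlgF d) m" and f: "f = on_mor InfF k \<odot>\<^bsub>D\<^esub> unit d"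
      by (rule hom_factors_through_unit[OF d m])
    \<comment> \<open>The witness \<open>unit d\<close> depends on neither \<open>f\<close> nor
      \<open>m\<close>, so a single arrow serves every comparison.\<close>
    have "Err (unit d) \<preceq>\<^bsub>S\<^esub> Err f"
      unfolding f using unit_hom[OF d] G.map_hom[OF k] by (rule err_le_err_comp)
    with unit_hom[OF d]
    show "\<exists>g \<in> Hom D d (on_obj InfF (on_obj AlgF d)). Err g \<preceq>\<^bsub>S\<^esub> Err f" ..
  qed
  then show "global_error_minimiser M D InfF S Err d (on_obj AlgF d)"
    using F.map_obj[OF d] by (simp add: global_error_minimiser_def)
qed

end
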